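(* For all integers $1\le d\le n$ there exists a set $X\subset\mathbb{Z}$ with $|X|=n$ such that the discrete interval disjointness function $\mathrm{Disj}_X|_{\mathcal{I}\times\mathcal{I}}$ satisfies $$D(\mathrm{Disj}_X|_{\mathcal{I}\times\mathcal{I}})=\Theta\left(d\log\tfrac{n}{d}\right),\quad D^{\rightarrow}(\mathrm{Disj}_X|_{\mathcal{I}\times\mathcal{I}})=\Theta\left(d\log\tfrac{n}{d}\right),\quad R^{\rightarrow}(\mathrm{Disj}_X|_{\mathcal{I}\times\mathcal{I}})=\Theta\left(d\log\tfrac{n}{d}\right).$$
   Context: Communication complexity: for a function $f:\Omega_1\times\Omega_2\to\Omega$, Alice receives $x\in\Omega_1$, Bob receives $y\in\Omega_2$, and they exchange bits to compute $f(x,y)$. $D(f)$ is the minimum over deterministic protocols of the worst-case number of bits exchanged (any number of rounds). In the randomized setting Alice and Bob share an infinite public random string and on every input the output must be correct with probability at least $2/3$; $R(f)$ is the minimum worst-case number of bits exchanged by such a protocol. $D^{\rightarrow}(f)$ and $R^{\rightarrow}(f)$ are the one-way versions: only Alice sends a message to Bob, and Bob computes the output. Discrete interval disjointness: $\mathrm{Int}$ is the set of all intervals of $\mathbb{R}$ and $\mathcal{I}$ is the collection of all $d$-element subsets of $\mathrm{Int}$. For a finite $X\subset\mathbb{Z}$, the function $\mathrm{Disj}_X|_{\mathcal{I}\times\mathcal{I}}:\mathcal{I}\times\mathcal{I}\to\{0,1\}$ takes $(\{I_1,\dots,I_d\},\{I'_1,\dots,I'_d\})$ to $1$ if $I_i\cap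 I'_j\cap X=\emptyset$ for all $i,j\in[d]$, and to $0$ otherwise. The set $X$ is known to both players. Asymptotic notation: the constants implied in $O,\Omega,\Theta$ are absolute (independent of $n$ and $d$), and the bounds are asserted whenever $n/d$ is at least some absolute constant. *)

theory Defs
  imports "HOL-Probability.Probability" "HOL-Library.Extended_Nat"
begin

text \<open>
  Both input domains are given as sets \<open>A\<close>, \<open>B\<close>, so a protocol is only constrained on \<open>A \<times> B\<close>.
  The complexity measures take values in \<open>enat\<close>: the infimum of the empty set is \<open>\<infinity>\<close>, so a function
  that no protocol computes has infinite complexity.
\<close>

subsection \<open>Deterministic two-way protocols\<close>

text \<open>
  At an inner node the named player sends the bit determined by the predicate on their own input;
  the first subtree is taken on \<open>False\<close>, the second on \<open>True\<close>. A leaf carries the common output.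
\<close>

datatype ('a, 'b, 'z) protocol =
    Output 'z
  | Alice_Sends "'a \<Rightarrow> bool" "('a, 'b, 'z) protocol" "('a, 'b, 'z) protocol"
  | Bob_Sends "'b \<Rightarrow> bool" "('a, 'b, 'z) protocol" "('a, 'b, 'z) protocol"

primrec run :: "('a, 'b, 'z) protocol \<Rightarrow> 'a \<Rightarrow> 'b \<Rightarrow> 'z" where
  "run (Output z) x y = z"
| "run (Alice_Sends q P Q) x y = (if q x then run Q x y else run P x y)"
| "run (Bob_Sends q P Q) x y = (if q y then run Q x y else run P x y)"

primrec bits_exchanged :: "('a, 'b, 'z) protocol \<Rightarrow> 'a \<Rightarrow> 'b \<Rightarrow> nat" where
  "bits_exchanged (Output z) x y = 0"
| "bits_exchanged (Alice_Sends q P Q) x y =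
     Suc (if q x then bits_exchanged Q x y else bits_exchanged P x y)"
| "bits_exchanged (Bob_Sends q P Q) x y =
     Suc (if q y then bits_exchanged Q x y else bits_exchanged P x y)"

definition det_cc :: "'a set \<Rightarrow> 'b set \<Rightarrow> ('a \<Rightarrow> 'b \<Rightarrow> 'z) \<Rightarrow> enat" where
  "det_cc A B f = Inf {enat k | k. \<exists>P :: ('a, 'b, 'z) protocol.
     \<forall>x\<in>A. \<forall>y\<in>B. run P x y = f x y \<and> bits_exchanged P x y \<le> k}"

subsection \<open>One-way protocols\<close>

text \<open>
  All messages have the same length \<open>k\<close>. This loses nothing: the end of a message must be
  recognisable to Bob, i.e. messages form a prefix-free code, and such a code of maximal length \<open>k\<close>
  can be padded to length \<open>k\<close>.
\<close>

definition det_oneway_cc :: "'a set \<Rightarrow> 'b set \<Rightarrow> ('a \<Rightarrow> 'b \<Rightarrow> 'z) \<Rightarrow> enat" where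
  "det_oneway_cc A B f = Inf {enat k | k. \<exists>(msg :: 'a \<Rightarrow> bool list) (out :: bool list \<Rightarrow> 'b \<Rightarrow> 'z).
     (\<forall>x\<in>A. length (msg x) = k) \<and>
     (\<forall>x\<in>A. \<forall>y\<in>B. out (msg x) y = f x y)}"

definition public_coins :: "(nat \<Rightarrow> bool) measure" where
  "public_coins = PiM UNIV (\<lambda>_. measure_pmf (bernoulli_pmf (1/2)))"

definition rand_oneway_cc :: "'a set \<Rightarrow> 'b set \<Rightarrow> ('a \<Rightarrow> 'b \<Rightarrow> 'z) \<Rightarrow> enat" where
  "rand_oneway_cc A B f = Inf {enat k | k.
     \<exists>(msg :: (nat \<Rightarrow> bool) \<Rightarrow> 'a \<Rightarrow> bool list) (out :: (nat \<Rightarrow> bool) \<Rightarrow> bool list \<Rightarrow> 'b \<Rightarrow> 'z).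
     (\<forall>r. \<forall>x\<in>A. length (msg r x) = k) \<and>
     (\<forall>x\<in>A. \<forall>y\<in>B.
        {r. out r (msg r x) y = f x y} \<in> sets public_coins \<and>
        measure public_coins {r. out r (msg r x) y = f x y} \<ge> 2/3)}"

subsection \<open>Discrete interval disjointness\<close>

definition interval_families :: "nat \<Rightarrow> real set set set" where
  "interval_families d = {S. S \<subseteq> {I. is_interval I} \<and> finite S \<and> card S = d}"

text \<open>The values \<open>1\<close> and \<open>0\<close> of the disjointness function are \<open>True\<close> and \<open>False\<close>.\<close>

definition disj_on :: "int set \<Rightarrow> real set set \<Rightarrow> real set set \<Rightarrow> bool" where
  "disj_on X S T \<longleftrightarrow> (\<forall>I\<in>S. \<forall>J\<in>T. I \<inter> J \<inter> real_of_int ` X = {})"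

end

theory Submission imports Defs begin

text \<open>
  Take \<open>X = {0..<n}\<close>. The trace on \<open>X\<close> of a union of \<open>d\<close> intervals is determined by its at most
  \<open>2d\<close> boundary points, so there are \<open>(n/d)\<close> to the power \<open>O(d)\<close> traces, and Alice can send a
  name of hers.

  For the lower bounds split \<open>X\<close> into \<open>d\<close> blocks of \<open>2\<^sup>t\<close> points with \<open>t\<close> about \<open>log (n/d)\<close>. Alice
  holds an initial segment of each block and Bob a final segment of each block, and they are
  disjoint iff Alice's vector of lengths is dominated by Bob's vector of starting points. The pairs
  with equal vectors form a fooling set of size \<open>2\<close> to the power \<open>dt\<close>. In the randomized case read
  Alice's vector as \<open>N = dt\<close> bits. Knowing the bits before position \<open>i\<close>, Bob can learn bit \<open>i\<close>
  by a single comparison (augmented index). For a fixed message Bob is then a sequential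
  predictor, and over all inputs \<open>2\<close> to the power of the number of its correct predictions sums to
  \<open>3\<^sup>N\<close>. As \<open>2N/3\<close> predictions are correct on average, Jensen's inequality leaves a message length of
  at least \<open>(5/3 - log 3) N\<close>, which is linear in \<open>N\<close> because \<open>27 < 32\<close>.
\<close>

section \<open>Infima in \<open>enat\<close> and relations between the protocol models\<close>

text \<open>Rounding \<open>c\<close> up keeps the argument inside \<open>enat\<close>: a natural
  number at least \<open>c\<close> is at least \<open>nat \<lceil>c\<rceil>\<close>. The value
  \<open>\<infinity>\<close> of an empty infimum is covered as well.\<close>

lemma ereal_le_Inf_enat:
  assumes "\<And>k. P k \<Longrightarrow> c \<le> real k"
  shows "ereal c \<le> ereal_of_enat (Inf {enat k | k. P k})"
proof -
  have "enat (nat \<lceil>c\<rceil>) \<le> Inf {enat k | k. P k}"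
    using assms by (intro Inf_greatest) (auto simp: nat_le_iff ceiling_le_iff)
  then have "ereal_of_enat (enat (nat \<lceil>c\<rceil>)) \<le> ereal_of_enat (Inf {enat k | k. P k})"
    by (simp only: ereal_of_enat_le_iff)
  moreover have "ereal c \<le> ereal_of_enat (enat (nat \<lceil>c\<rceil>))"
    by (simp add: real_nat_ceiling_ge)
  ultimately show ?thesis by (rule order_trans[rotated])
qed

lemma det_oneway_cc_le:
  fixes msg :: "'a \<Rightarrow> bool list"
  assumes "\<forall>x\<in>A. length (msg x) = k" "\<forall>x\<in>A. \<forall>y\<in>B. out (msg x) y = f x y"
  shows "det_oneway_cc A B f \<le> enat k"
  unfolding det_oneway_cc_def using assms by (intro Inf_lower) blast

lemma prob_space_public_coins: "prob_space public_coins"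
  unfolding public_coins_def by (intro prob_space_PiM prob_space_measure_pmf)

lemma space_public_coins [simp]: "space public_coins = UNIV"
  unfolding public_coins_def by (simp add: space_PiM)

lemma rand_oneway_cc_le_det_oneway_cc: "rand_oneway_cc A B f \<le> det_oneway_cc A B f"
  unfolding det_oneway_cc_def
proof (rule Inf_greatest, clarify)
  interpret prob_space public_coins by (rule prob_space_public_coins)
  fix k msg and out :: "bool list \<Rightarrow> 'b \<Rightarrow> 'c"
  assume l: "\<forall>x\<in>A. length (msg x) = k" and o: "\<forall>x\<in>A. \<forall>y\<in>B. out (msg x) y = f x y"
  have "{r. out (msg x) y = f x y} = space public_coins" if "x \<in> A" "y \<in> B" for x y
    using o that by simp
  then have "\<forall>x\<in>A. \<forall>y\<in>B. {r. out (msg x) y = f x y} \<in> sets public_coins \<and>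
      measure public_coins {r. out (msg x) y = f x y} \<ge> 2/3"
    using prob_space sets.top[of public_coins] by simp
  then show "rand_oneway_cc A B f \<le> enat k"
    unfolding rand_oneway_cc_def using l
    by (intro Inf_lower CollectI exI[of _ k] conjI refl exI[of _ "\<lambda>_. msg"] exI[of _ "\<lambda>_. out"])
      simp_all
qed

text \<open>The list \<open>w\<close> holds the bits sent so far, so \<open>length w\<close> indexes
  the next one. A leaf carries an output common to both players, so Bob announces his result with
  one extra bit.\<close>

primrec oneway_protocol ::
  "('a \<Rightarrow> bool list) \<Rightarrow> (bool list \<Rightarrow> 'b \<Rightarrow> bool) \<Rightarrow> nat \<Rightarrow> bool list \<Rightarrow> ('a, 'b, bool) protocol" where
  "oneway_protocol msg out 0 w = Bob_Sends (out w) (Output False) (Output True)"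
| "oneway_protocol msg out (Suc k) w = Alice_Sends (\<lambda>x. msg x ! length w)
     (oneway_protocol msg out k (w @ [False])) (oneway_protocol msg out k (w @ [True]))"

lemma oneway_protocol_correct:
  assumes "length (msg x) = length w + k" "take (length w) (msg x) = w"
  shows "run (oneway_protocol msg out k w) x y = out (msg x) y \<and>
    bits_exchanged (oneway_protocol msg out k w) x y = Suc k"
  using assms
proof (induction k arbitrary: w)
  case 0
  then show ?case by simp
next
  case (Suc k)
  have "take (length (w @ [msg x ! length w])) (msg x) = w @ [msg x ! length w]"
    using Suc.prems by (simp add: take_Suc_conv_app_nth)
  then have "run (oneway_protocol msg out k (w @ [msg x ! length w])) x y = out (msg x) y \<and>
    bits_exchanged (oneway_protocol msg out k (w @ [msg x ! length w])) x y = Suc k"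
    using Suc.prems by (intro Suc.IH) auto
  then show ?case by (cases "msg x ! length w") auto
qed

lemma det_cc_le_Suc:
  fixes f :: "'a \<Rightarrow> 'b \<Rightarrow> bool" and msg :: "'a \<Rightarrow> bool list"
  assumes "\<forall>x\<in>A. length (msg x) = k" "\<forall>x\<in>A. \<forall>y\<in>B. out (msg x) y = f x y"
  shows "det_cc A B f \<le> enat (Suc k)"
proof -
  have "\<forall>x\<in>A. \<forall>y\<in>B. run (oneway_protocol msg out k []) x y = f x y \<and>
      bits_exchanged (oneway_protocol msg out k []) x y \<le> Suc k"
    using assms oneway_protocol_correct[of msg _ "[]" k out] by simp
  then show ?thesis unfolding det_cc_def by (intro Inf_lower) blast
qed

text \<open>The message is a code word for \<open>h x\<close>; Bob decodes it to some representative
  with the same value of \<open>h\<close> and evaluates \<open>f\<close> there, which is correct by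
  \<open>dep\<close>.\<close>

lemma ex_oneway_encoding:
  assumes fin: "finite (h ` A)" and card: "card (h ` A) \<le> 2 ^ k"
    and dep: "\<And>x x' y. x \<in> A \<Longrightarrow> x' \<in> A \<Longrightarrow> y \<in> B \<Longrightarrow> h x = h x' \<Longrightarrow> f x y = f x' y"
  obtains msg :: "'a \<Rightarrow> bool list" and out
  where "\<forall>x\<in>A. length (msg x) = k" "\<forall>x\<in>A. \<forall>y\<in>B. out (msg x) y = f x y"
proof -
  have c: "card {xs :: bool list. length xs = k} = 2 ^ k"
    using card_lists_length_eq[of "UNIV :: bool set" k] by simp
  have fl: "finite {xs :: bool list. length xs = k}"
    using finite_lists_length_eq[of "UNIV :: bool set" k] by simp
  obtain g where g: "g ` h ` A \<subseteq> {xs :: bool list. length xs = k}" "inj_on g (h ` A)"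
    using card_le_inj[OF fin fl] card c by auto
  define dec where "dec w = (SOME x. x \<in> A \<and> g (h x) = w)" for w
  have "dec (g (h x)) \<in> A \<and> g (h (dec (g (h x)))) = g (h x)" if "x \<in> A" for x
    unfolding dec_def by (rule someI_ex) (use that in auto)
  then have "dec (g (h x)) \<in> A" "h (dec (g (h x))) = h x" if "x \<in> A" for x
    using g(2) that by (auto dest: inj_onD)
  then have "\<forall>x\<in>A. \<forall>y\<in>B. f (dec (g (h x))) y = f x y"
    using dep by blast
  moreover have "\<forall>x\<in>A. length (g (h x)) = k"
    using g(1) by blast
  ultimately show thesis
    using that[of "g \<circ> h" "\<lambda>w. f (dec w)"] by simp
qed

section \<open>Fooling sets\<close>

text \<open>Each sent bit splits \<open>I\<close> in two. Within one half even the crossed pairs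
  take the same branch, because the bit depends on the sender's input alone, so the half is a
  fooling set for a subtree with one bit less to spend. At a leaf the output is constant, which
  leaves at most one index.\<close>

lemma fooling_set_bound:
  assumes "finite I"
    and "\<And>i. i \<in> I \<Longrightarrow> run P (S i) (T i) = z \<and> bits_exchanged P (S i) (T i) \<le> k"
    and "\<And>i j. i \<in> I \<Longrightarrow> j \<in> I \<Longrightarrow> i \<noteq> j \<Longrightarrow> run P (S i) (T j) \<noteq> z \<or> run P (S j) (T i) \<noteq> z"
  shows "card I \<le> 2 ^ k"
  using assms
proof (induction P arbitrary: I k)
  case (Output w)
  then have "i = j" if "i \<in> I" "j \<in> I" for i j
    using that by force
  then have "card I \<le> 1"
    by (metis Output.prems(1) card_le_Suc0_iff_eq One_nat_def)
  then show ?case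
    using one_le_power[of "2::nat" k] by linarith
next
  case (Alice_Sends q P Q)
  show ?case
  proof (cases k)
    case 0
    then have "I = {}" using Alice_Sends.prems(2) by fastforce
    then show ?thesis by simp
  next
    case (Suc k')
    let ?I = "{i \<in> I. q (S i)}" and ?J = "{i \<in> I. \<not> q (S i)}"
    have "card ?I \<le> 2 ^ k'"
      using Alice_Sends.prems Suc by (intro Alice_Sends.IH(2)) fastforce+
    moreover have "card ?J \<le> 2 ^ k'"
      using Alice_Sends.prems Suc by (intro Alice_Sends.IH(1)) fastforce+
    moreover have "I = ?I \<union> ?J" by auto
    then have "card I \<le> card ?I + card ?J" by (metis card_Un_le)
    ultimately show ?thesis using Suc by simp
  qed
next
  case (Bob_Sends q P Q)
  show ?case
  proof (cases k)
    case 0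
    then have "I = {}" using Bob_Sends.prems(2) by fastforce
    then show ?thesis by simp
  next
    case (Suc k')
    let ?I = "{i \<in> I. q (T i)}" and ?J = "{i \<in> I. \<not> q (T i)}"
    have "card ?I \<le> 2 ^ k'"
      using Bob_Sends.prems Suc by (intro Bob_Sends.IH(2)) fastforce+
    moreover have "card ?J \<le> 2 ^ k'"
      using Bob_Sends.prems Suc by (intro Bob_Sends.IH(1)) fastforce+
    moreover have "I = ?I \<union> ?J" by auto
    then have "card I \<le> card ?I + card ?J" by (metis card_Un_le)
    ultimately show ?thesis using Suc by simp
  qed
qed

section \<open>Sequential prediction and augmented index\<close>

lemma finite_bool_lists: "finite {a :: bool list. length a = N}"
  using finite_lists_length_eq[of "UNIV :: bool set" N] by simp

lemma card_bool_lists: "card {a :: bool list. length a = N} = 2 ^ N"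
  using card_lists_length_eq[of "UNIV :: bool set" N] by simp

text \<open>
  Recording at which positions a sequential predictor errs is a bijection on bit strings, so the
  sum is the one for the binomial distribution.
\<close>

lemma sum_two_power_correct_predictions:
  fixes p :: "bool list \<Rightarrow> bool"
  shows "(\<Sum>a | length a = N. (2::real) ^ card {i. i < N \<and> p (take i a) = a ! i}) = 3 ^ N"
proof (induction N)
  case 0
  have "{a :: bool list. length a = 0} = {[]}" by auto
  then show ?case by simp
next
  case (Suc N)
  let ?c = "\<lambda>N a. card {i. i < N \<and> p (take i a) = a ! i}"
  have lists: "{a :: bool list. length a = Suc N} = (\<lambda>(b, x). b @ [x]) ` ({b. length b = N} \<times> UNIV)"
    by (auto simp: image_iff length_Suc_conv_rev)
  have inj: "inj_on (\<lambda>(b, x). b @ [x]) ({b :: bool list. length b = N} \<times> UNIV)"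
    by (auto simp: inj_on_def)
  have c: "?c (Suc N) (b @ [x]) = ?c N b + (if p b = x then 1 else 0)" if "length b = N" for b x
  proof -
    have "{i. i < Suc N \<and> p (take i (b @ [x])) = (b @ [x]) ! i} =
        {i. i < N \<and> p (take i b) = b ! i} \<union> (if p b = x then {N} else {})"
      using that by (auto simp: less_Suc_eq nth_append)
    then show ?thesis by auto
  qed
  have "(\<Sum>a | length a = Suc N. (2::real) ^ ?c (Suc N) a) =
      (\<Sum>b | length b = N. \<Sum>x\<in>UNIV. 2 ^ ?c (Suc N) (b @ [x]))"
    unfolding lists by (subst sum.reindex[OF inj]) (simp add: sum.cartesian_product case_prod_beta del: take_append)
  \<comment> \<open>Exactly one of the two continuations \<open>x\<close> agrees with the prediction
    \<open>p b\<close>, hence the factor \<open>2 + 1\<close>.\<close>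
  also have "\<dots> = (\<Sum>b | length b = N. 3 * 2 ^ ?c N b)"
    by (intro sum.cong refl) (auto simp: c UNIV_bool simp del: take_append)
  finally show ?case
    using Suc by (simp add: sum_distrib_left[symmetric])
qed

text \<open>The convex function \<open>2 powr m\<close> lies above its tangent at
  \<open>\<mu>\<close>. Summed over \<open>A\<close>, the linear term of the tangent is nonnegative
  because the total of \<open>X\<close> is at least \<open>\<mu> * card A\<close>.\<close>

lemma two_powr_jensen:
  fixes X :: "'a \<Rightarrow> nat"
  assumes "finite A" and "\<mu> * real (card A) \<le> (\<Sum>a\<in>A. real (X a))"
  shows "2 powr \<mu> * real (card A) \<le> (\<Sum>a\<in>A. 2 ^ X a)"
proof -
  have *: "2 powr \<mu> * (1 + ln 2 * (real m - \<mu>)) \<le> 2 ^ m" for m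
  proof -
    have "1 + ln 2 * (real m - \<mu>) \<le> exp (ln 2 * (real m - \<mu>))" by (rule exp_ge_add_one_self)
    also have "\<dots> = 2 powr (real m - \<mu>)" by (simp add: powr_def mult.commute)
    finally have "2 powr \<mu> * (1 + ln 2 * (real m - \<mu>)) \<le> 2 powr \<mu> * 2 powr (real m - \<mu>)"
      by (intro mult_left_mono) auto
    then show ?thesis by (simp add: powr_add[symmetric] powr_realpow)
  qed
  have "0 \<le> ln 2 * ((\<Sum>a\<in>A. real (X a)) - \<mu> * real (card A))"
    using assms(2) by simp
  then have "2 powr \<mu> * real (card A) \<le>
      2 powr \<mu> * (real (card A) + ln 2 * ((\<Sum>a\<in>A. real (X a)) - \<mu> * real (card A)))"
    by (intro mult_left_mono) auto
  also have "\<dots> = (\<Sum>a\<in>A. 2 powr \<mu> * (1 + ln 2 * (real (X a) - \<mu>)))"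
    by (simp add: sum_distrib_left[symmetric] sum.distrib sum_subtractf mult.commute[of "real (card A)"])
  also have "\<dots> \<le> (\<Sum>a\<in>A. 2 ^ X a)"
    by (intro sum_mono *)
  finally show ?thesis .
qed

lemma augmented_index_deterministic:
  fixes msg :: "bool list \<Rightarrow> bool list" and pred :: "bool list \<Rightarrow> bool list \<Rightarrow> bool"
  assumes len: "\<And>a. length a = N \<Longrightarrow> length (msg a) = k"
    and avg: "2/3 * (real N * 2 ^ N) \<le>
      (\<Sum>a | length a = N. real (card {i. i < N \<and> pred (msg a) (take i a) = a ! i}))"
  shows "(5/3 - log 2 3) * real N \<le> real k"
proof -
  let ?A = "{a :: bool list. length a = N}" and ?W = "{w :: bool list. length w = k}"
  let ?X = "\<lambda>w a. card {i. i < N \<and> pred w (take i a) = a ! i}"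
  have "2 powr (2/3 * real N) * 2 ^ N \<le> (\<Sum>a\<in>?A. (2::real) ^ ?X (msg a) a)"
    using two_powr_jensen[OF finite_bool_lists, of "2/3 * real N" N "\<lambda>a. ?X (msg a) a"] avg
    by (simp add: card_bool_lists mult.assoc)
  \<comment> \<open>Summing over all messages instead of the actual one frees the predictor from
    \<open>a\<close>, so the exact value \<open>3 ^ N\<close> applies to each fixed
    \<open>w\<close>.\<close>
  also have "\<dots> \<le> (\<Sum>a\<in>?A. \<Sum>w\<in>?W. (2::real) ^ ?X w a)"
  proof (rule sum_mono)
    fix a assume "a \<in> ?A"
    then show "(2::real) ^ ?X (msg a) a \<le> (\<Sum>w\<in>?W. 2 ^ ?X w a)"
      using len by (intro member_le_sum[of "msg a" ?W "\<lambda>w. 2 ^ ?X w a"]) (auto simp: finite_bool_lists)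
  qed
  also have "\<dots> = 2 ^ k * 3 ^ N"
    by (subst sum.swap) (simp add: sum_two_power_correct_predictions card_bool_lists)
  finally have "2 powr (2/3 * real N) * 2 powr real N \<le> 2 powr real k * 3 powr real N"
    by (simp add: powr_realpow)
  then have "2 powr (5/3 * real N) \<le> 2 powr real k * 2 powr (log 2 3 * real N)"
    by (simp add: powr_add[symmetric] powr_powr[symmetric])
  then have "2 powr (5/3 * real N) \<le> 2 powr (real k + log 2 3 * real N)"
    by (simp add: powr_add)
  then show ?thesis by (simp add: algebra_simps)
qed

text \<open>Averaging fixes the coins: the expected number of correct predictions, totalled over all
  \<open>a\<close>, is at least \<open>2/3 * (N * 2 ^ N)\<close>, so some outcome \<open>r\<close>
  attains this and the deterministic bound applies to \<open>msg r\<close> and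
  \<open>pred r\<close>.\<close>

lemma (in prob_space) augmented_index:
  fixes msg :: "'a \<Rightarrow> bool list \<Rightarrow> bool list" and pred :: "'a \<Rightarrow> bool list \<Rightarrow> bool list \<Rightarrow> bool"
  assumes len: "\<And>r a. r \<in> space M \<Longrightarrow> length a = N \<Longrightarrow> length (msg r a) = k"
    and meas: "\<And>a i. length a = N \<Longrightarrow> i < N \<Longrightarrow>
      {r \<in> space M. pred r (msg r a) (take i a) = a ! i} \<in> events"
    and prob: "\<And>a i. length a = N \<Longrightarrow> i < N \<Longrightarrow>
      prob {r \<in> space M. pred r (msg r a) (take i a) = a ! i} \<ge> 2/3"
  shows "(5/3 - log 2 3) * real N \<le> real k"
proof -
  let ?A = "{a :: bool list. length a = N}"
  let ?E = "\<lambda>a i. {r \<in> space M. pred r (msg r a) (take i a) = a ! i}"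
  define s where "s r = (\<Sum>a\<in>?A. \<Sum>i<N. indicator (?E a i) r :: real)" for r
  have int: "integrable M (\<lambda>r. indicator (?E a i) r :: real)" if "a \<in> ?A" "i < N" for a i
    using meas that by (simp add: integrable_indicator_iff emeasure_eq_measure)
  have ints: "integrable M s"
    unfolding s_def using int by (intro Bochner_Integration.integrable_sum) auto
  have "expectation s = (\<Sum>a\<in>?A. \<Sum>i<N. prob (?E a i))"
  proof -
    have "expectation s = (\<Sum>a\<in>?A. expectation (\<lambda>r. \<Sum>i<N. indicator (?E a i) r))"
      unfolding s_def using int
      by (intro Bochner_Integration.integral_sum Bochner_Integration.integrable_sum) auto
    also have "\<dots> = (\<Sum>a\<in>?A. \<Sum>i<N. expectation (indicator (?E a i)))"
      using int by (intro sum.cong refl Bochner_Integration.integral_sum) auto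
    also have "\<dots> = (\<Sum>a\<in>?A. \<Sum>i<N. prob (?E a i))"
      by (intro sum.cong refl) (simp add: Int_def conj_commute cong: conj_cong)
    finally show ?thesis .
  qed
  also have "\<dots> \<ge> (\<Sum>a\<in>?A. \<Sum>i<N. 2/3)"
    using prob by (intro sum_mono) auto
  finally have E: "2/3 * (real N * 2 ^ N) \<le> expectation s"
    by (simp add: card_bool_lists mult_ac)
  obtain r where r: "r \<in> space M" "2/3 * (real N * 2 ^ N) \<le> s r"
  proof (rule ccontr)
    assume "\<not> thesis"
    then have "AE r in M. s r < 2/3 * (real N * 2 ^ N)"
      using that by (intro AE_I2) force
    then have "expectation s < 2/3 * (real N * 2 ^ N)"
      by (rule expectation_less[OF ints])
    then show False using E by simp
  qed
  have "s r = (\<Sum>a\<in>?A. real (card {i. i < N \<and> pred r (msg r a) (take i a) = a ! i}))"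
    unfolding s_def
  proof (intro sum.cong refl)
    fix a
    have "{i \<in> {..<N}. r \<in> ?E a i} = {i. i < N \<and> pred r (msg r a) (take i a) = a ! i}"
      using r(1) by auto
    then show "(\<Sum>i<N. indicator (?E a i) r :: real) =
        real (card {i. i < N \<and> pred r (msg r a) (take i a) = a ! i})"
      by (simp add: indicator_def sum.If_cases Int_def Collect_conj_eq[symmetric] r(1))
  qed
  then show ?thesis
    using r len by (intro augmented_index_deterministic[of N "msg r" k "pred r"]) auto
qed

section \<open>Vector domination as disjointness of interval families\<close>

lemma disj_on_commute: "disj_on X S T = disj_on X T S"
  unfolding disj_on_def by (auto simp: Int_commute)

text \<open>A constructed family may have fewer than the required \<open>d\<close> members, for
  instance when several of its intervals are empty. Singletons of reals outside \<open>X\<close>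
  fill the gap without affecting disjointness on \<open>X\<close>.\<close>

lemma ex_padded_interval_family:
  assumes "finite X" "finite F" "card F \<le> d" "\<And>I. I \<in> F \<Longrightarrow> is_interval I"
  shows "\<exists>S \<in> interval_families d. \<forall>T. disj_on X S T = disj_on X F T"
proof -
  let ?D = "(\<lambda>x::real. {x}) ` (- real_of_int ` X) - F"
  have "infinite (- real_of_int ` X)"
    using assms(1) by (simp add: Compl_eq_Diff_UNIV Diff_infinite_finite infinite_UNIV_char_0)
  then have "infinite ?D"
    using assms(2) by (intro Diff_infinite_finite) (auto simp: finite_image_iff inj_on_def)
  then obtain G where G: "finite G" "card G = d - card F" "G \<subseteq> ?D"
    using infinite_arbitrarily_large by blast
  have "card (F \<union> G) = d"
    using G assms by (subst card_Un_disjoint) auto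
  moreover have "is_interval I" if I: "I \<in> G" for I
  proof -
    obtain x where "I = {x}" using I G(3) by blast
    then show ?thesis by (simp add: is_interval_1)
  qed
  ultimately have "F \<union> G \<in> interval_families d"
    using G(1) assms(2,4) by (auto simp: interval_families_def)
  moreover have "disj_on X (F \<union> G) T = disj_on X F T" for T
    using G(3) unfolding disj_on_def by blast
  ultimately show ?thesis by blast
qed

text \<open>In block \<open>j\<close> the two segments meet exactly when \<open>w j < v j\<close>,
  and segments of different blocks never meet. Choosing \<open>w j = m\<close> makes Bob's segment
  empty and switches the condition for block \<open>j\<close> off; the randomized reduction relies
  on this.\<close>

lemma ex_block_families:
  assumes X: "X = {0..<int n}" and dm: "d * m \<le> n"
  obtains L U :: "(nat \<Rightarrow> nat) \<Rightarrow> real set set"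
  where "\<And>v. L v \<in> interval_families d" "\<And>w. U w \<in> interval_families d"
    "\<And>v w. (\<And>j. j < d \<Longrightarrow> v j \<le> m) \<Longrightarrow> (\<And>j. j < d \<Longrightarrow> w j \<le> m) \<Longrightarrow>
      disj_on X (L v) (U w) \<longleftrightarrow> (\<forall>j<d. v j \<le> w j)"
proof -
  define L0 where "L0 v = (\<lambda>j. {real (j*m) ..< real (j*m + v j)}) ` {..<d}" for v
  define U0 where "U0 w = (\<lambda>j. {real (j*m + w j) ..< real (j*m + m)}) ` {..<d}" for w
  have fX: "finite X" by (simp add: X)
  have card: "card (f ` {..<d}) \<le> d" for f :: "nat \<Rightarrow> real set"
    using card_image_le[of "{..<d}" f] by simp
  have "\<exists>S\<in>interval_families d. \<forall>T. disj_on X S T = disj_on X (L0 v) T" for v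
    unfolding L0_def by (intro ex_padded_interval_family fX card) (auto simp: is_interval_1)
  then obtain L where L: "L v \<in> interval_families d" "disj_on X (L v) T = disj_on X (L0 v) T" for v T
    by metis
  have "\<exists>S\<in>interval_families d. \<forall>T. disj_on X S T = disj_on X (U0 w) T" for w
    unfolding U0_def by (intro ex_padded_interval_family fX card) (auto simp: is_interval_1)
  then obtain U where U: "U w \<in> interval_families d" "disj_on X (U w) T = disj_on X (U0 w) T" for w T
    by metis
  have "disj_on X (L v) (U w) \<longleftrightarrow> (\<forall>j<d. v j \<le> w j)"
    if v: "\<And>j. j < d \<Longrightarrow> v j \<le> m" and w: "\<And>j. j < d \<Longrightarrow> w j \<le> m" for v w
  proof -
    have "disj_on X (L v) (U w) = disj_on X (L0 v) (U0 w)"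
      using L(2) U(2) disj_on_commute by metis
    also have "\<dots> \<longleftrightarrow> (\<forall>j<d. v j \<le> w j)"
    proof (intro iffI allI impI)
      fix j assume D: "disj_on X (L0 v) (U0 w)" and j: "j < d"
      show "v j \<le> w j"
      proof (rule ccontr)
        assume c: "\<not> v j \<le> w j"
        \<comment> \<open>The point at offset \<open>w j\<close> of block \<open>j\<close> lies in
          both segments, and in \<open>X\<close> because the blocks fit below
          \<open>n\<close>.\<close>
        have "j * m + m \<le> d * m"
          using j by (metis Suc_leI add.commute mult_Suc mult_le_mono1)
        then have "j*m + w j < n"
          using c v[OF j] dm by linarith
        then have "int (j*m + w j) \<in> X"
          by (simp only: X atLeastLessThan_iff of_nat_less_iff of_nat_0_le_iff)
        moreover have "real (j*m + w j) = real_of_int (int (j*m + w j))" by simp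
        ultimately have "real (j*m + w j) \<in> real_of_int ` X" by blast
        moreover have "real (j*m + w j) \<in> {real (j*m) ..< real (j*m + v j)}"
          "real (j*m + w j) \<in> {real (j*m + w j) ..< real (j*m + m)}"
          using c v[OF j] by (simp_all del: of_nat_mult)
        ultimately show False
          using D j unfolding disj_on_def L0_def U0_def by blast
      qed
    next
      assume le: "\<forall>j<d. v j \<le> w j"
      have False if j: "j < d" and j': "j' < d"
        and z: "z \<in> X" "real_of_int z \<in> {real (j*m) ..< real (j*m + v j)}"
          "real_of_int z \<in> {real (j'*m + w j') ..< real (j'*m + m)}" for j j' z
      proof -
        \<comment> \<open>Segments stay inside their blocks, so \<open>y div m\<close> identifies
          both \<open>j\<close> and \<open>j'\<close>.\<close>
        define y where "y = nat z"
        have "real_of_int z = real y" using z(1) by (simp add: X y_def)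
        then have y: "j*m \<le> y" "y < j*m + v j" "j'*m + w j' \<le> y" "y < j'*m + m"
          using z(2,3) by (simp_all only: atLeastLessThan_iff of_nat_le_iff of_nat_less_iff)
        have "y < j*m + m" using y v[OF j] by linarith
        then have "j = y div m" using y by (intro div_nat_eqI[symmetric]) (auto simp: mult.commute)
        moreover have "j' = y div m" using y by (intro div_nat_eqI[symmetric]) (auto simp: mult.commute)
        ultimately show False using y le j by fastforce
      qed
      then show "disj_on X (L0 v) (U0 w)"
        unfolding disj_on_def L0_def U0_def by blast
    qed
    finally show ?thesis .
  qed
  then show thesis using that L(1) U(1) by blast
qed

section \<open>Deterministic and randomized lower bounds\<close>

lemma det_cc_disj_on_lower:
  assumes X: "X = {0..<int n}" and dm: "d * 2 ^ t \<le> n"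
  shows "ereal (real (d * t)) \<le> ereal_of_enat (det_cc (interval_families d) (interval_families d) (disj_on X))"
  unfolding det_cc_def
proof (rule ereal_le_Inf_enat, elim exE)
  fix k P
  assume P: "\<forall>x\<in>interval_families d. \<forall>y\<in>interval_families d.
    run P x y = disj_on X x y \<and> bits_exchanged P x y \<le> k"
  obtain L U :: "(nat \<Rightarrow> nat) \<Rightarrow> real set set" where LU: "\<And>v. L v \<in> interval_families d" "\<And>w. U w \<in> interval_families d"
    "\<And>v w. (\<And>j. j < d \<Longrightarrow> v j \<le> 2 ^ t) \<Longrightarrow> (\<And>j. j < d \<Longrightarrow> w j \<le> 2 ^ t) \<Longrightarrow>
      disj_on X (L v) (U w) \<longleftrightarrow> (\<forall>j<d. v j \<le> w j)"
    using ex_block_families[OF X dm] by blast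
  let ?I = "PiE {..<d} (\<lambda>_. {..<2 ^ t :: nat})"
  have le: "v j \<le> 2 ^ t" if "v \<in> ?I" "j < d" for v j
    using that by (auto simp: PiE_iff less_imp_le)
  have D: "run P (L v) (U w) \<longleftrightarrow> (\<forall>j<d. v j \<le> w j)" if "v \<in> ?I" "w \<in> ?I" for v w
    using P LU(1,2) LU(3)[of v w] le that by simp
  have "card ?I \<le> 2 ^ k"
  proof (rule fooling_set_bound[where P = P and S = L and T = U and z = True])
    show "finite ?I" by (auto intro: finite_PiE)
    show "run P (L v) (U v) = True \<and> bits_exchanged P (L v) (U v) \<le> k" if "v \<in> ?I" for v
      using D that P LU(1,2) by simp
    \<comment> \<open>Distinct vectors cannot dominate each other, so one of the two crossed pairs
      is not disjoint.\<close>
    fix v w assume vw: "v \<in> ?I" "w \<in> ?I" "v \<noteq> w"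
    then obtain j where "j < d" "v j \<noteq> w j" by (meson PiE_ext lessThan_iff)
    then show "run P (L v) (U w) \<noteq> True \<or> run P (L w) (U v) \<noteq> True"
      using D vw by (meson antisym)
  qed
  then have "(2::nat) ^ (t * d) \<le> 2 ^ k" by (simp add: card_PiE power_mult)
  then have "t * d \<le> k" by simp
  then show "real (d * t) \<le> real k" by (simp add: mult.commute flip: of_nat_mult)
qed

text \<open>\<open>horner_sum\<close> reads the least significant bit first; after reversal the head
  is the most significant bit, so a known prefix fixes the leading digits.\<close>

abbreviation bits_value :: "bool list \<Rightarrow> nat" where
  "bits_value xs \<equiv> horner_sum of_bool 2 (rev xs)"

lemma bits_value_less: "bits_value xs < 2 ^ length xs"
  using horner_sum_of_bool_2_less[of "rev xs", where ?'a = nat] by simp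

text \<open>The bound is the value of \<open>p @ [True]\<close> followed by \<open>length s\<close>
  zeros. With \<open>x\<close> false, no choice of \<open>s\<close> reaches it.\<close>

lemma bits_value_less_iff:
  "bits_value (p @ x # s) < (2 * bits_value p + 1) * 2 ^ length s \<longleftrightarrow> \<not> x"
  using bits_value_less[of s] by (auto simp: horner_sum_append algebra_simps)

lemma rand_oneway_cc_disj_on_lower:
  assumes X: "X = {0..<int n}" and dm: "d * 2 ^ t \<le> n"
  shows "ereal ((5/3 - log 2 3) * real (d * t)) \<le>
    ereal_of_enat (rand_oneway_cc (interval_families d) (interval_families d) (disj_on X))"
  unfolding rand_oneway_cc_def
proof (rule ereal_le_Inf_enat, elim exE conjE)
  interpret prob_space public_coins by (rule prob_space_public_coins)
  fix k msg and out :: "(nat \<Rightarrow> bool) \<Rightarrow> bool list \<Rightarrow> real set set \<Rightarrow> bool"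
  assume len: "\<forall>r. \<forall>x\<in>interval_families d. length (msg r x) = k"
    and prob: "\<forall>x\<in>interval_families d. \<forall>y\<in>interval_families d.
      {r. out r (msg r x) y = disj_on X x y} \<in> sets public_coins \<and>
      2/3 \<le> measure public_coins {r. out r (msg r x) y = disj_on X x y}"
  obtain L U :: "(nat \<Rightarrow> nat) \<Rightarrow> real set set" where LU: "\<And>v. L v \<in> interval_families d" "\<And>w. U w \<in> interval_families d"
    "\<And>v w. (\<And>j. j < d \<Longrightarrow> v j \<le> 2 ^ t) \<Longrightarrow> (\<And>j. j < d \<Longrightarrow> w j \<le> 2 ^ t) \<Longrightarrow>
      disj_on X (L v) (U w) \<longleftrightarrow> (\<forall>j<d. v j \<le> w j)"
    using ex_block_families[OF X dm] by blast
  define v where "v a j = bits_value (take t (drop (j * t) a))" for a j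
  text \<open>Bob's threshold continues the known bits of the current block by \<open>1\<close> and then zeros.\<close>
  define q where "q p = (2 * bits_value (drop (length p div t * t) p) + 1) * 2 ^ (t - 1 - length p mod t)" for p
  \<comment> \<open>Domination is non-strict, so \<open>v a j < q p\<close> is expressed through
    \<open>q p - 1\<close>, where \<open>q p\<close> is positive. The value \<open>2 ^ t\<close>
    imposes nothing on the other blocks.\<close>
  define w where "w p j = (if j = length p div t then q p - 1 else 2 ^ t)" for p j
  have disj: "disj_on X (L (v a)) (U (w (take i a))) \<longleftrightarrow> \<not> a ! i"
    if a: "length a = d * t" and i: "i < d * t" for a i
  proof -
    let ?j = "i div t" and ?l = "i mod t"
    have t: "0 < t" using i by (cases t) auto
    have j: "?j < d" using i by (simp add: less_mult_imp_div_less)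
    have l: "?l < t" using t by simp
    let ?b = "take t (drop (?j * t) a)"
    have "?j * t + t \<le> d * t"
      using j by (metis Suc_leI add.commute mult_Suc mult_le_mono1)
    then have lb: "length ?b = t" using a by simp
    have p: "drop (?j * t) (take i a) = take ?l ?b"
    proof -
      have "i - ?j * t = ?l" by (simp add: minus_div_mult_eq_mod)
      then show ?thesis using l by (simp add: drop_take min_def)
    qed
    have nth: "?b ! ?l = a ! i"
      using l a i j by (subst nth_take, simp, subst nth_drop) simp_all
    have b: "?b = take ?l ?b @ a ! i # drop (Suc ?l) ?b"
      using id_take_nth_drop[of ?l ?b] l lb nth by simp
    have q_eq: "q (take i a) = (2 * bits_value (take ?l ?b) + 1) * 2 ^ (t - 1 - ?l)"
    proof -
      have "length (take i a) = i" using a i by simp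
      then show ?thesis unfolding q_def by (simp only: p)
    qed
    have less_iff: "v a ?j < q (take i a) \<longleftrightarrow> \<not> a ! i"
    proof -
      have "q (take i a) = (2 * bits_value (take ?l ?b) + 1) * 2 ^ length (drop (Suc ?l) ?b)"
        unfolding q_eq using lb by simp
      moreover have "v a ?j = bits_value (take ?l ?b @ a ! i # drop (Suc ?l) ?b)"
        unfolding v_def using b by simp
      ultimately show ?thesis by (simp only: bits_value_less_iff)
    qed
    have q: "0 < q (take i a)" by (simp add: q_def)
    have v_le: "v a j \<le> 2 ^ t" for j
    proof -
      have "v a j < 2 ^ length (take t (drop (j * t) a))"
        unfolding v_def by (rule bits_value_less)
      also have "\<dots> \<le> 2 ^ t" by (intro power_increasing) auto
      finally show ?thesis by simp
    qed
    have "q (take i a) \<le> 2 ^ t"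
    proof -
      have "bits_value (take ?l ?b) < 2 ^ ?l"
        using bits_value_less[of "take ?l ?b"] l lb by (metis length_take min.strict_order_iff min.commute)
      then have "2 * bits_value (take ?l ?b) + 1 \<le> 2 ^ Suc ?l" by simp
      then have "q (take i a) \<le> 2 ^ Suc ?l * 2 ^ (t - 1 - ?l)"
        unfolding q_eq by (rule mult_le_mono1)
      also have "\<dots> = 2 ^ t" using l by (simp flip: power_add power_Suc)
      finally show ?thesis .
    qed
    then have w_le: "w (take i a) j \<le> 2 ^ t" for j by (auto simp: w_def)
    have "disj_on X (L (v a)) (U (w (take i a))) \<longleftrightarrow> (\<forall>j<d. v a j \<le> w (take i a) j)"
      using LU(3) v_le w_le by blast
    also have "\<dots> \<longleftrightarrow> v a ?j < q (take i a)"
      using j v_le q a i by (auto simp: w_def min_def)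
    finally show ?thesis using less_iff by simp
  qed
  \<comment> \<open>Disjointness means that bit \<open>i\<close> is false, so the negated output is
    the guess, and it is right exactly when the protocol is.\<close>
  have ev: "{r \<in> space public_coins. (\<not> out r (msg r (L (v a))) (U (w (take i a)))) = a ! i} =
      {r. out r (msg r (L (v a))) (U (w (take i a))) = disj_on X (L (v a)) (U (w (take i a)))}"
    if "length a = d * t" "i < d * t" for a i
    using disj[OF that] by auto
  show "(5/3 - log 2 3) * real (d * t) \<le> real k"
  proof (rule augmented_index[of "d * t" "\<lambda>r a. msg r (L (v a))" k "\<lambda>r m p. \<not> out r m (U (w p))"])
    show "length (msg r (L (v a))) = k" for r a
      using len LU(1) by blast
    fix a :: "bool list" and i assume ai: "length a = d * t" "i < d * t"
    show "{r \<in> space public_coins. (\<not> out r (msg r (L (v a))) (U (w (take i a)))) = a ! i} \<in> events"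
      "2/3 \<le> prob {r \<in> space public_coins. (\<not> out r (msg r (L (v a))) (U (w (take i a)))) = a ! i}"
      unfolding ev[OF ai] using prob LU(1,2) by blast+
  qed
qed

section \<open>Upper bound by counting traces\<close>

text \<open>This is the support of the discrete derivative of the indicator of
  \<open>V\<close>.\<close>

definition boundary :: "int set \<Rightarrow> int set" where
  "boundary V = {x. (x \<in> V) \<noteq> (x - 1 \<in> V)}"

text \<open>Membership is recovered from left to right: the boundary tells where it switches, and it
  is false at \<open>-1\<close>.\<close>

lemma boundary_inject:
  assumes "V \<subseteq> {0..<n}" "W \<subseteq> {0..<n}" "boundary V = boundary W"
  shows "V = W"
proof -
  have "x \<in> V \<longleftrightarrow> x \<in> W" if "-1 \<le> x" for x
    using that
  proof (induction x rule: int_ge_induct)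
    case base
    then show ?case using assms(1,2) by auto
  next
    case (step x)
    have "(x + 1 \<in> boundary V) = (x + 1 \<in> boundary W)" using assms(3) by simp
    then show ?case using step.IH by (auto simp: boundary_def)
  qed
  moreover have "-1 \<le> x" if "x \<in> V \<or> x \<in> W" for x
    using assms(1,2) that by fastforce
  ultimately show ?thesis by blast
qed

lemma boundary_UN_subset: "boundary (\<Union>i\<in>I. V i) \<subseteq> (\<Union>i\<in>I. boundary (V i))"
  unfolding boundary_def by blast

text \<open>The trace of an interval is a run of consecutive integers, so membership switches only
  at its first point and just after its last. An empty \<open>V\<close> has empty boundary, whatever
  \<open>Min V\<close> and \<open>Max V\<close> are.\<close>

lemma boundary_interval:
  assumes "is_interval I" and "V = {z \<in> {0..<n}. real_of_int z \<in> I}"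
  shows "boundary V \<subseteq> {Min V, Max V + 1}"
proof
  have mid: "y \<in> V" if "a \<in> V" "b \<in> V" "a \<le> y" "y \<le> b" for a b y
  proof -
    have "real_of_int a \<in> I" "real_of_int b \<in> I" using that assms(2) by auto
    then have "real_of_int y \<in> I"
      using assms(1) that(3,4) unfolding is_interval_1 by (meson of_int_le_iff)
    then show ?thesis using that assms(2) by auto
  qed
  have fin: "finite V" unfolding assms(2) by (rule finite_subset[of _ "{0..<n}"]) auto
  fix x assume "x \<in> boundary V"
  then consider "x \<in> V" "x - 1 \<notin> V" | "x \<notin> V" "x - 1 \<in> V"
    by (auto simp: boundary_def)
  then show "x \<in> {Min V, Max V + 1}"
  proof cases
    case 1
    \<comment> \<open>By \<open>mid\<close>, an element below \<open>x\<close> would force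
      \<open>x - 1\<close> into \<open>V\<close>. The other case is dual.\<close>
    then have "Min V = x"
      using mid[of _ x "x - 1"] by (intro Min_eqI fin) force+
    then show ?thesis by simp
  next
    case 2
    then have "Max V = x - 1"
      using mid[of "x - 1" _ x] by (intro Max_eqI fin) force+
    then show ?thesis by simp
  qed
qed

text \<open>As \<open>x \<le> 1\<close>, each counted set has weight \<open>x ^ card B\<close> at
  least \<open>x ^ k\<close>, and the weights of all subsets of \<open>Y\<close> sum to a binomial
  product.\<close>

lemma card_small_subsets:
  fixes x :: real
  assumes "finite Y" "0 < x" "x \<le> 1"
  shows "real (card {B. B \<subseteq> Y \<and> card B \<le> k}) * x ^ k \<le> (1 + x) ^ card Y"
proof -
  have "real (card {B. B \<subseteq> Y \<and> card B \<le> k}) * x ^ k = (\<Sum>B | B \<subseteq> Y \<and> card B \<le> k. x ^ k)"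
    by simp
  also have "\<dots> \<le> (\<Sum>B | B \<subseteq> Y \<and> card B \<le> k. x ^ card B)"
    using assms by (intro sum_mono power_decreasing) auto
  also have "\<dots> \<le> (\<Sum>B\<in>Pow Y. x ^ card B)"
    using assms by (intro sum_mono2) auto
  also have "\<dots> = (\<Prod>y\<in>Y. 1 + x)"
    using prod_add[OF assms(1), of "\<lambda>_. x" "\<lambda>_. 1"] by (simp add: add.commute)
  finally show ?thesis by simp
qed

lemma ex_disj_on_encoding:
  assumes X: "X = {0..<int n}" and d: "1 \<le> d" and nd: "2 \<le> real n / real d"
  obtains msg :: "real set set \<Rightarrow> bool list" and out and k
  where "\<forall>S\<in>interval_families d. length (msg S) = k"
    "\<forall>S\<in>interval_families d. \<forall>T\<in>interval_families d. out (msg S) T = disj_on X S T"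
    "real k \<le> 6 * (real d * log 2 (real n / real d))"
proof -
  let ?F = "interval_families d"
  let ?L = "log 2 (real n / real d)"
  define tr where "tr S = (\<Union>I\<in>S. {z \<in> {0..<int n}. real_of_int z \<in> I})" for S
  define h where "h S = boundary (tr S)" for S
  have tr: "disj_on X S T \<longleftrightarrow> (\<forall>z\<in>tr S. \<forall>J\<in>T. real_of_int z \<notin> J)" for S T
    unfolding disj_on_def tr_def X by fastforce
  have tr_sub: "tr S \<subseteq> {0..<int n}" for S unfolding tr_def by blast
  have card_h: "card (h S) \<le> 2 * d" and h_sub: "h S \<subseteq> {0..int n}" if "S \<in> ?F" for S
  proof -
    have S: "finite S" "card S = d" "\<And>I. I \<in> S \<Longrightarrow> is_interval I"
      using that by (auto simp: interval_families_def)
    let ?V = "\<lambda>I. {z \<in> {0..<int n}. real_of_int z \<in> I}"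
    have "h S \<subseteq> (\<Union>I\<in>S. boundary (?V I))"
      unfolding h_def tr_def by (rule boundary_UN_subset)
    also have "\<dots> \<subseteq> (\<Union>I\<in>S. {Min (?V I), Max (?V I) + 1})"
      using boundary_interval[OF S(3) refl] by (intro UN_mono) auto
    finally have "card (h S) \<le> card (\<Union>I\<in>S. {Min (?V I), Max (?V I) + 1})"
      using S(1) by (intro card_mono) auto
    also have "\<dots> \<le> (\<Sum>I\<in>S. card {Min (?V I), Max (?V I) + 1})"
      by (rule card_UN_le[OF S(1)])
    also have "\<dots> \<le> (\<Sum>I\<in>S. 2)"
      by (intro sum_mono) (auto simp: card_insert_if)
    finally show "card (h S) \<le> 2 * d" using S(2) by simp
    show "h S \<subseteq> {0..int n}"
      using tr_sub[of S] unfolding h_def boundary_def by force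
  qed
  \<comment> \<open>A trace containing \<open>n - 1\<close> has \<open>n\<close> in its boundary, so
    there are \<open>n + 1\<close> candidate points.\<close>
  let ?C = "{B. B \<subseteq> {0..int n} \<and> card B \<le> 2 * d}"
  have sub: "h ` ?F \<subseteq> ?C" using card_h h_sub by blast
  have finC: "finite ?C" by (rule finite_subset[of _ "Pow {0..int n}"]) auto
  have n: "2 * d \<le> n" "0 < n" using nd d by (simp_all add: field_simps)
  text \<open>This weight balances the two factors in \<open>card_small_subsets\<close> up to constants.\<close>
  define x where "x = real d / real n"
  have x: "0 < x" "x \<le> 1" using n d by (auto simp: x_def)
  have "real (card ?C) * x ^ (2 * d) \<le> (1 + x) ^ Suc n"
    using card_small_subsets[OF _ x, of "{0..int n}" "2 * d"] by (simp add: nat_add_distrib)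
  also have "\<dots> \<le> exp x ^ Suc n"
    using x exp_ge_add_one_self[of x] by (intro power_mono) auto
  also have "\<dots> = exp (real (Suc n) * x)" by (rule exp_of_nat_mult[symmetric])
  also have "\<dots> \<le> exp (2 * real d)"
    using n d by (simp add: x_def field_simps)
  finally have C: "real (card ?C) * x ^ (2 * d) \<le> exp (2 * real d)" .
  \<comment> \<open>This converts \<open>exp (2 * d)\<close> into \<open>2 powr (3 * d)\<close>; it
    follows from \<open>2.8 ^ 2 \<le> 8\<close>.\<close>
  have e: "exp (1::real) \<le> 2 powr (3/2)"
  proof -
    have "exp (1::real) ^ 2 \<le> (2 powr (3/2)) ^ 2"
    proof -
      have "exp (1::real) ^ 2 \<le> (28/10) ^ 2"
        using e_less_272 by (intro power_mono) auto
      also have "\<dots> \<le> (2::real) powr 3" by (simp add: power2_eq_square)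
      finally show ?thesis by (simp add: power2_eq_square flip: powr_add)
    qed
    then show ?thesis by (rule power2_le_imp_le) simp
  qed
  have inv: "x ^ (2 * d) * 2 powr (2 * real d * ?L) = 1"
  proof -
    have "2 powr (2 * real d * ?L) = (2 powr ?L) powr real (2 * d)"
      by (simp add: powr_powr mult_ac)
    also have "\<dots> = (real n / real d) ^ (2 * d)"
      using n d by (subst powr_log_cancel) (simp_all add: powr_realpow del: of_nat_mult)
    finally show ?thesis using n d by (simp add: x_def power_divide)
  qed
  \<comment> \<open>The factor 5 collects \<open>3 * d\<close>, at most \<open>3 * d * ?L\<close>
    since \<open>1 \<le> ?L\<close>, and \<open>2 * d * ?L\<close>. The ceiling later costs at most
    one more \<open>d * ?L\<close>.\<close>
  define k where "k = nat \<lceil>5 * real d * ?L\<rceil>"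
  have L: "1 \<le> ?L" using nd by (simp add: le_log_iff)
  have dL: "1 \<le> real d * ?L"
    using mult_mono[of 1 "real d" 1 ?L] d L by simp
  have "real (card ?C) = real (card ?C) * x ^ (2 * d) * 2 powr (2 * real d * ?L)"
    using inv by (simp add: mult.assoc)
  also have "\<dots> \<le> exp (2 * real d) * 2 powr (2 * real d * ?L)"
    by (intro mult_right_mono C) auto
  also have "\<dots> \<le> 2 powr (3 * real d) * 2 powr (2 * real d * ?L)"
  proof -
    have "exp (2 * real d) = exp 1 powr (2 * real d)" by (simp add: powr_def)
    also have "\<dots> \<le> (2 powr (3/2)) powr (2 * real d)" by (intro powr_mono2 e) auto
    finally show ?thesis by (intro mult_right_mono) (auto simp: powr_powr)
  qed
  also have "\<dots> = 2 powr (3 * real d + 2 * real d * ?L)" by (simp add: powr_add)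
  also have "\<dots> \<le> 2 powr real k"
  proof -
    have "3 * real d + 2 * real d * ?L \<le> 5 * real d * ?L"
      using L d by (simp add: algebra_simps)
    also have "\<dots> \<le> real k" unfolding k_def by (rule real_nat_ceiling_ge)
    finally show ?thesis by simp
  qed
  finally have "real (card ?C) \<le> real (2 ^ k)" by (simp add: powr_realpow)
  then have "card (h ` ?F) \<le> 2 ^ k"
    using card_mono[OF finC sub] by (simp only: of_nat_le_iff)
  moreover have "finite (h ` ?F)" using finC sub by (rule finite_subset[rotated])
  moreover have "disj_on X S T = disj_on X S' T" if "h S = h S'" for S S' T
    using boundary_inject[OF tr_sub tr_sub, of S S'] that by (simp add: h_def tr)
  ultimately obtain msg :: "real set set \<Rightarrow> bool list" and out
    where "\<forall>S\<in>?F. length (msg S) = k" "\<forall>S\<in>?F. \<forall>T\<in>?F. out (msg S) T = disj_on X S T"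
    using ex_oneway_encoding[of h ?F k ?F "disj_on X"] by blast
  moreover have "real k \<le> 6 * (real d * ?L)"
  proof -
    have "real k \<le> 5 * real d * ?L + 1"
    proof -
      have "0 \<le> 5 * real d * ?L" using dL by linarith
      then have "real k = of_int \<lceil>5 * real d * ?L\<rceil>" by (simp add: k_def)
      then show ?thesis by linarith
    qed
    then show ?thesis using dL by linarith
  qed
  ultimately show thesis using that by blast
qed

section \<open>Combining the bounds with explicit constants\<close>

theorem theorem3:
  "\<exists>c C K :: real. 0 < c \<and> 0 < C \<and> 0 < K \<and>
     (\<forall>d n :: nat. 1 \<le> d \<and> d \<le> n \<longrightarrow>
       (\<exists>X :: int set. finite X \<and> card X = n \<and>
         (K \<le> real n / real d \<longrightarrow>
            ereal_of_enat (det_cc (interval_families d) (interval_families d) (disj_on X))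
              \<in> {ereal (c * (real d * log 2 (real n / real d))) ..
                 ereal (C * (real d * log 2 (real n / real d)))} \<and>
            ereal_of_enat (det_oneway_cc (interval_families d) (interval_families d) (disj_on X))
              \<in> {ereal (c * (real d * log 2 (real n / real d))) ..
                 ereal (C * (real d * log 2 (real n / real d)))} \<and>
            ereal_of_enat (rand_oneway_cc (interval_families d) (interval_families d) (disj_on X))
              \<in> {ereal (c * (real d * log 2 (real n / real d))) ..
                 ereal (C * (real d * log 2 (real n / real d)))})))"
proof -
  define c0 :: real where "c0 = 5/3 - log 2 3"
  have "log 2 3 < (5/3 :: real)"
  proof -
    have "3 * log 2 3 = log 2 (3 ^ 3 :: real)" by (subst log_nat_power) auto
    also have "\<dots> < log 2 (2 ^ 5)" by simp
    also have "\<dots> = (5 :: real)" by (subst log_nat_power) auto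
    finally show ?thesis by simp
  qed
  then have c0: "0 < c0" by (simp add: c0_def)
  \<comment> \<open>This weakens the fooling set bound \<open>d * t\<close> to
    \<open>c0 * (d * t)\<close>, so one lower constant serves all three measures.\<close>
  have c0_1: "c0 \<le> 1"
  proof -
    have "(1::real) \<le> log 2 3" by (simp add: le_log_iff)
    then show ?thesis unfolding c0_def by linarith
  qed
  \<comment> \<open>The remaining two bounds follow because randomized one-way complexity is at most
    the deterministic one.\<close>
  have main: "ereal (c0 / 2 * (real d * log 2 (real n / real d))) \<le>
        ereal_of_enat (rand_oneway_cc (interval_families d) (interval_families d) (disj_on X)) \<and>
      ereal (c0 / 2 * (real d * log 2 (real n / real d))) \<le>
        ereal_of_enat (det_cc (interval_families d) (interval_families d) (disj_on X)) \<and>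
      ereal_of_enat (det_oneway_cc (interval_families d) (interval_families d) (disj_on X)) \<le>
        ereal (7 * (real d * log 2 (real n / real d))) \<and>
      ereal_of_enat (det_cc (interval_families d) (interval_families d) (disj_on X)) \<le>
        ereal (7 * (real d * log 2 (real n / real d)))"
    if d: "1 \<le> d" and nd: "2 \<le> real n / real d" and X: "X = {0..<int n}" for d n :: nat and X
  proof -
    let ?L = "log 2 (real n / real d)" and ?F = "interval_families d"
    have L: "1 \<le> ?L" using nd by (simp add: le_log_iff)
    have dL: "1 \<le> real d * ?L" using mult_mono[of 1 "real d" 1 ?L] d L by simp
    \<comment> \<open>Since \<open>1 \<le> ?L\<close>, rounding down loses at most a factor 2, which
      becomes the 2 in \<open>c0 / 2\<close>.\<close>
    define t where "t = nat \<lfloor>?L\<rfloor>"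
    have t: "real t \<le> ?L" "?L \<le> 2 * real t"
    proof -
      have "real t = of_int \<lfloor>?L\<rfloor>" "1 \<le> \<lfloor>?L\<rfloor>"
        using L by (simp_all add: t_def)
      then show "real t \<le> ?L" "?L \<le> 2 * real t" by linarith+
    qed
    have "2 powr real t \<le> 2 powr ?L" using t(1) by simp
    also have "\<dots> = real n / real d" using nd by (intro powr_log_cancel) auto
    finally have "real (d * 2 ^ t) \<le> real n"
      using d by (simp add: powr_realpow field_simps)
    then have dm: "d * 2 ^ t \<le> n" by (simp only: of_nat_le_iff)
    have half: "real d * ?L \<le> 2 * real (d * t)"
      using mult_left_mono[OF t(2), of "real d"] by simp
    have l1: "c0 / 2 * (real d * ?L) \<le> c0 * real (d * t)"
      using mult_left_mono[OF half, of "c0 / 2"] c0 by simp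
    have l2: "c0 * real (d * t) \<le> real (d * t)"
      using mult_right_mono[OF c0_1, of "real (d * t)"] by simp
    obtain msg :: "real set set \<Rightarrow> bool list" and out k where
      P: "\<forall>S\<in>?F. length (msg S) = k" "\<forall>S\<in>?F. \<forall>T\<in>?F. out (msg S) T = disj_on X S T"
      and k: "real k \<le> 6 * (real d * ?L)"
      by (rule ex_disj_on_encoding[OF X d nd])
    have u1: "ereal_of_enat (det_oneway_cc ?F ?F (disj_on X)) \<le> ereal_of_enat (enat k)"
      using det_oneway_cc_le[OF P] by (simp only: ereal_of_enat_le_iff)
    have u2: "ereal_of_enat (det_cc ?F ?F (disj_on X)) \<le> ereal_of_enat (enat (Suc k))"
      using det_cc_le_Suc[OF P] by (simp only: ereal_of_enat_le_iff)
    have k1: "ereal_of_enat (enat k) \<le> ereal (7 * (real d * ?L))" using k dL by simp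
    have k2: "ereal_of_enat (enat (Suc k)) \<le> ereal (7 * (real d * ?L))" using k dL by simp
    show ?thesis
    proof (intro conjI)
      show "ereal (c0 / 2 * (real d * ?L)) \<le> ereal_of_enat (rand_oneway_cc ?F ?F (disj_on X))"
        using rand_oneway_cc_disj_on_lower[OF X dm] l1 unfolding c0_def
        by (meson ereal_less_eq(3) order_trans)
      show "ereal (c0 / 2 * (real d * ?L)) \<le> ereal_of_enat (det_cc ?F ?F (disj_on X))"
        using det_cc_disj_on_lower[OF X dm] l1 l2
        by (meson ereal_less_eq(3) order_trans)
    qed (rule order_trans[OF u1 k1] order_trans[OF u2 k2])+
  qed
  have rd: "ereal_of_enat (rand_oneway_cc A B f) \<le> ereal_of_enat (det_oneway_cc A B f)"
    for A B :: "real set set set" and f :: "real set set \<Rightarrow> real set set \<Rightarrow> bool"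
    using rand_oneway_cc_le_det_oneway_cc by (simp only: ereal_of_enat_le_iff)
  show ?thesis
  \<comment> \<open>The threshold 2 makes the logarithm at least 1. The 7 is the 6 of the encoding
    plus 1 for Bob's announced output bit in the two-way protocol.\<close>
  proof (rule exI[of _ "c0 / 2"], rule exI[of _ 7], rule exI[of _ 2], intro conjI allI impI)
    fix d n :: nat assume dn: "1 \<le> d \<and> d \<le> n"
    show "\<exists>X :: int set. finite X \<and> card X = n \<and>
         (2 \<le> real n / real d \<longrightarrow>
            ereal_of_enat (det_cc (interval_families d) (interval_families d) (disj_on X))
              \<in> {ereal (c0 / 2 * (real d * log 2 (real n / real d))) ..
                 ereal (7 * (real d * log 2 (real n / real d)))} \<and>
            ereal_of_enat (det_oneway_cc (interval_families d) (interval_families d) (disj_on X))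
              \<in> {ereal (c0 / 2 * (real d * log 2 (real n / real d))) ..
                 ereal (7 * (real d * log 2 (real n / real d)))} \<and>
            ereal_of_enat (rand_oneway_cc (interval_families d) (interval_families d) (disj_on X))
              \<in> {ereal (c0 / 2 * (real d * log 2 (real n / real d))) ..
                 ereal (7 * (real d * log 2 (real n / real d)))})"
    proof (intro exI[of _ "{0..<int n}"] conjI impI)
      assume "2 \<le> real n / real d"
      note bounds = main[OF _ this refl] and rd = rd[of "interval_families d" "interval_families d" "disj_on {0..<int n}"]
      show "ereal_of_enat (det_cc (interval_families d) (interval_families d) (disj_on {0..<int n}))
              \<in> {ereal (c0 / 2 * (real d * log 2 (real n / real d))) ..
                 ereal (7 * (real d * log 2 (real n / real d)))}"
        "ereal_of_enat (det_oneway_cc (interval_families d) (interval_families d) (disj_on {0..<int n}))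
              \<in> {ereal (c0 / 2 * (real d * log 2 (real n / real d))) ..
                 ereal (7 * (real d * log 2 (real n / real d)))}"
        "ereal_of_enat (rand_oneway_cc (interval_families d) (interval_families d) (disj_on {0..<int n}))
              \<in> {ereal (c0 / 2 * (real d * log 2 (real n / real d))) ..
                 ereal (7 * (real d * log 2 (real n / real d)))}"
        using bounds rd dn unfolding atLeastAtMost_iff by (meson order_trans)+
    qed simp_all
  qed (use c0 in auto)
qed

end
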